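(* Let $(X,\kappa)$ be a digital image with the approximate fixed point property (AFPP), and let $n \ge 0$ be an integer. Then the digital image $\left(X \times [0,n]_{\mathbb{Z}},\, NP(\kappa,c_1)\right)$ has the AFPP.
   Context: A digital image $(X,\kappa)$ is a set $X$ (of lattice points in some $\mathbb{Z}^m$) together with an adjacency relation $\kappa$ on $X$, i.e., a symmetric irreflexive relation. Write $x \leftrightarrow_\kappa y$ if $x,y$ are $\kappa$-adjacent. A subset $A\subset X$ is $\kappa$-connected if for all $a,b \in A$ there is a sequence $a=x_0,\dots,x_k=b$ in $A$ with $x_i \leftrightarrow_\kappa x_{i+1}$ or $x_i = x_{i+1}$ for $0\le i<k$. A function $f: X \to X$ is $\kappa$-continuous if it maps $\kappa$-connected subsets to $\kappa$-connected subsets (equivalently, $x \leftrightarrow_\kappa x'$ implies that $f(x) \leftrightarrow_\kappa f(x')$ or $f(x) = f(x')$). $(X,\kappa)$ has the AFPP if for every $\kappa$-continuous $f: X \to X$ there is a point $x\in X$ with $f(x) \leftrightarrow_\kappa x$ or $f(x) = x$. For integers $a \le b$, $[a,b]_{\mathbb{Z}} = \{t \in \mathbb{Z} : a \le t \le b\}$. The $c_1$-adjacency on $\mathbb{Z}$ is: $s,t$ are $c_1$-adjacent iff $|s-t|=1$. For digital images $(X,\kappa)$ and $(Y,\lambda)$, the normal product adjacency $NP(\kappa,\lambda)$ on $X\times Y$ is: $(x,y)$ and $(x',y')$ are adjacent iff ($x \leftrightarrow_\kappa x'$ and $y=y'$), or ($x=x'$ and $y \leftrightarrow_\lambda y'$),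 or ($x \leftrightarrow_\kappa x'$ and $y \leftrightarrow_\lambda y'$). *)

theory Defs
  imports "HOL-Analysis.Finite_Cartesian_Product" "HOL-Library.FuncSet"
begin

text \<open>
  Adjacencies are binary predicates on the ambient type; only their values on points of the
  image are ever used.  The lattice \<open>\<int>\<^sup>m\<close> is the type \<open>int ^ 'm\<close>.  The definitions are polymorphic
  in the type of points because a product of images in \<open>\<int>\<^sup>m\<close> and \<open>\<int>\<close> is taken to live in
  \<open>(int ^ 'm) \<times> int\<close>, that is, in \<open>\<int>\<^sup>m \<times> \<int> = \<int>\<^bsup>m+1\<^esup>\<close>.
\<close>

definition digital_image :: "'a set \<Rightarrow> ('a \<Rightarrow> 'a \<Rightarrow> bool) \<Rightarrow> bool" where
  "digital_image X \<kappa> \<longleftrightarrow> symp_on X \<kappa> \<and> irreflp_on X \<kappa>"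

definition dig_connected :: "('a \<Rightarrow> 'a \<Rightarrow> bool) \<Rightarrow> 'a set \<Rightarrow> bool" where
  "dig_connected \<kappa> A \<longleftrightarrow>
     (\<forall>a\<in>A. \<forall>b\<in>A. \<exists>(k::nat) x. x 0 = a \<and> x k = b \<and> (\<forall>i\<le>k. x i \<in> A) \<and>
        (\<forall>i<k. \<kappa> (x i) (x (Suc i)) \<or> x i = x (Suc i)))"

definition dig_continuous :: "'a set \<Rightarrow> ('a \<Rightarrow> 'a \<Rightarrow> bool) \<Rightarrow> ('a \<Rightarrow> 'a) \<Rightarrow> bool" where
  "dig_continuous X \<kappa> f \<longleftrightarrow>
     f \<in> X \<rightarrow> X \<and> (\<forall>A\<subseteq>X. dig_connected \<kappa> A \<longrightarrow> dig_connected \<kappa> (f ` A))"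

definition AFPP :: "'a set \<Rightarrow> ('a \<Rightarrow> 'a \<Rightarrow> bool) \<Rightarrow> bool" where
  "AFPP X \<kappa> \<longleftrightarrow> (\<forall>f. dig_continuous X \<kappa> f \<longrightarrow> (\<exists>x\<in>X. \<kappa> (f x) x \<or> f x = x))"

definition c1 :: "int \<Rightarrow> int \<Rightarrow> bool" where
  "c1 s t \<longleftrightarrow> \<bar>s - t\<bar> = 1"

definition NP :: "('a \<Rightarrow> 'a \<Rightarrow> bool) \<Rightarrow> ('b \<Rightarrow> 'b \<Rightarrow> bool) \<Rightarrow> 'a \<times> 'b \<Rightarrow> 'a \<times> 'b \<Rightarrow> bool" where
  "NP \<kappa> \<mu> = (\<lambda>(x, y) (x', y').
     (\<kappa> x x' \<and> y = y') \<or> (x = x' \<and> \<mu> y y') \<or> (\<kappa> x x' \<and> \<mu> y y'))"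

lemma digital_image_c1: "digital_image Y c1"
  by (auto simp: digital_image_def c1_def symp_on_def irreflp_on_def)

lemma digital_image_NP:
  assumes "digital_image X \<kappa>" "digital_image Y \<mu>"
  shows "digital_image (X \<times> Y) (NP \<kappa> \<mu>)"
  using assms unfolding digital_image_def NP_def symp_on_def irreflp_on_def by auto

text \<open>The familiar characterization of continuity by adjacent points.\<close>

lemma dig_connected_pair_iff:
  assumes "digital_image X \<kappa>" "a \<in> X" "b \<in> X"
  shows "dig_connected \<kappa> {a, b} \<longleftrightarrow> \<kappa> a b \<or> a = b"
proof
  assume "dig_connected \<kappa> {a, b}"
  then have "\<exists>(k::nat) x. x 0 = a \<and> x k = b \<and> (\<forall>i\<le>k. x i \<in> {a, b}) \<and>
      (\<forall>i<k. \<kappa> (x i) (x (Suc i)) \<or> x i = x (Suc i))"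
    unfolding dig_connected_def by (elim ballE[of _ _ a] ballE[of _ _ b]) simp_all
  then obtain k :: nat and x where x: "x 0 = a" "x k = b" "\<forall>i\<le>k. x i \<in> {a, b}"
    "\<forall>i<k. \<kappa> (x i) (x (Suc i)) \<or> x i = x (Suc i)" by (elim exE conjE)
  show "\<kappa> a b \<or> a = b"
  proof (rule ccontr)
    assume n: "\<not> (\<kappa> a b \<or> a = b)"
    have "x i = a" if "i \<le> k" for i
      using that
    proof (induction i)
      case 0
      show ?case by (fact x(1))
    next
      case (Suc i)
      have "x i = a" using Suc.IH Suc_leD[OF Suc.prems] by simp
      moreover have "\<kappa> (x i) (x (Suc i)) \<or> x i = x (Suc i)" using x(4) Suc_le_lessD[OF Suc.prems] by simp
      moreover have "x (Suc i) = a \<or> x (Suc i) = b" using x(3) Suc.prems by blast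
      ultimately show ?case using n by metis
    qed
    from this[OF order_refl] x(2) n show False by simp
  qed
next
  assume ab: "\<kappa> a b \<or> a = b"
  have ba: "\<kappa> b a \<or> b = a"
    using ab assms by (metis digital_image_def symp_onD)
  have step: "\<exists>(k::nat) x. x 0 = c \<and> x k = d \<and> (\<forall>i\<le>k. x i \<in> {a, b}) \<and>
        (\<forall>i<k. \<kappa> (x i) (x (Suc i)) \<or> x i = x (Suc i))"
    if "\<kappa> c d \<or> c = d" "c \<in> {a, b}" "d \<in> {a, b}" for c d
    using that by (intro exI[of _ "1::nat"] exI[of _ "\<lambda>i. if i = 0 then c else d"]) simp
  show "dig_connected \<kappa> {a, b}"
    unfolding dig_connected_def
  proof (intro ballI)
    fix c d assume cd: "c \<in> {a, b}" "d \<in> {a, b}"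
    then have "\<kappa> c d \<or> c = d" using ab ba by (metis insertE singletonD)
    from step[OF this cd] show "\<exists>(k::nat) x. x 0 = c \<and> x k = d \<and> (\<forall>i\<le>k. x i \<in> {a, b}) \<and>
        (\<forall>i<k. \<kappa> (x i) (x (Suc i)) \<or> x i = x (Suc i))" .
  qed
qed

lemma dig_continuous_iff:
  assumes "digital_image X \<kappa>"
  shows "dig_continuous X \<kappa> f \<longleftrightarrow>
    f \<in> X \<rightarrow> X \<and> (\<forall>x\<in>X. \<forall>x'\<in>X. \<kappa> x x' \<longrightarrow> \<kappa> (f x) (f x') \<or> f x = f x')"
proof
  assume c: "dig_continuous X \<kappa> f"
  then have f: "f \<in> X \<rightarrow> X" unfolding dig_continuous_def by blast
  have "\<kappa> (f x) (f x') \<or> f x = f x'" if "x \<in> X" "x' \<in> X" "\<kappa> x x'" for x x'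
  proof -
    have "dig_connected \<kappa> {x, x'}"
      using dig_connected_pair_iff[OF assms that(1,2)] that(3) by simp
    moreover have "{x, x'} \<subseteq> X" using that(1,2) by simp
    ultimately have "dig_connected \<kappa> (f ` {x, x'})"
      using c unfolding dig_continuous_def by metis
    then have "dig_connected \<kappa> {f x, f x'}" by simp
    moreover have "f x \<in> X" "f x' \<in> X" using f that(1,2) by auto
    ultimately show ?thesis using dig_connected_pair_iff[OF assms] by simp
  qed
  with f show "f \<in> X \<rightarrow> X \<and> (\<forall>x\<in>X. \<forall>x'\<in>X. \<kappa> x x' \<longrightarrow> \<kappa> (f x) (f x') \<or> f x = f x')" by blast
next
  assume r: "f \<in> X \<rightarrow> X \<and> (\<forall>x\<in>X. \<forall>x'\<in>X. \<kappa> x x' \<longrightarrow> \<kappa> (f x) (f x') \<or> f x = f x')"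
  have "dig_connected \<kappa> (f ` A)" if A: "A \<subseteq> X" "dig_connected \<kappa> A" for A
    unfolding dig_connected_def
  proof (intro ballI)
    fix a' b' assume "a' \<in> f ` A" "b' \<in> f ` A"
    then obtain a b where ab: "a \<in> A" "b \<in> A" "a' = f a" "b' = f b" by blast
    have "\<exists>(k::nat) x. x 0 = a \<and> x k = b \<and> (\<forall>i\<le>k. x i \<in> A) \<and>
        (\<forall>i<k. \<kappa> (x i) (x (Suc i)) \<or> x i = x (Suc i))"
      using A(2)[unfolded dig_connected_def] ab(1,2) by simp
    then obtain k :: nat and x where x: "x 0 = a" "x k = b" "\<forall>i\<le>k. x i \<in> A"
      "\<forall>i<k. \<kappa> (x i) (x (Suc i)) \<or> x i = x (Suc i)" by (elim exE conjE)
    have "\<kappa> (f (x i)) (f (x (Suc i))) \<or> f (x i) = f (x (Suc i))" if "i < k" for i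
    proof -
      have "x i \<in> X" "x (Suc i) \<in> X" using x(3) A(1) that by auto
      then show ?thesis using r x(4) that by metis
    qed
    then show "\<exists>(k::nat) x. x 0 = a' \<and> x k = b' \<and> (\<forall>i\<le>k. x i \<in> f ` A) \<and>
        (\<forall>i<k. \<kappa> (x i) (x (Suc i)) \<or> x i = x (Suc i))"
      using x(1-3) ab(3,4) by (intro exI[of _ k] exI[of _ "\<lambda>i. f (x i)"]) simp
  qed
  with r show "dig_continuous X \<kappa> f" unfolding dig_continuous_def by simp
qed

end

theory Submission imports Defs begin

text \<open>
  Write a continuous self-map of \<open>X \<times> {0..n}\<close> as \<open>f (x, t) = (g (x, t), h (x, t))\<close>.  On the fibre
  over \<open>x\<close> the map \<open>h\<close> is a continuous self-map of an interval, so it nearly fixes some height.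
  If such a height \<open>s x\<close> can be chosen so that adjacent points receive heights differing by at
  most one, then \<open>x \<mapsto> g (x, s x)\<close> is a continuous self-map of \<open>X\<close>, and an approximate fixed point
  \<open>x\<close> of it yields the approximate fixed point \<open>(x, s x)\<close> of \<open>f\<close>.

  In the topological setting fixed heights cannot in general be selected continuously.  Here the
  least height \<open>t\<close> with \<open>h (x, t) \<le> t + 1\<close> does the job, thanks to the slack of one and to the
  diagonal adjacencies of the normal product: passing from \<open>(x, t)\<close> to \<open>(x', t + 1)\<close>, with \<open>x'\<close>
  adjacent to \<open>x\<close>, raises \<open>h\<close> by at most one, so the inequality at \<open>(x, t)\<close> implies the one at
  \<open>(x', t + 1)\<close>, and the least height rises by at most one.  This is
  \<open>nearly_fixed_height_selection\<close>.
\<close>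

text \<open>
  The least height \<open>t\<close> with \<open>h x t \<le> t + 1\<close> is nearly fixed.  If it is zero, then \<open>h x t \<ge> t\<close>
  trivially; otherwise \<open>h\<close> exceeds the height just below it by at least two, and in one step that
  excess drops by at most two, so it is not yet negative.
\<close>

lemma nearly_fixed_height_selection:
  fixes h :: "'a \<Rightarrow> int \<Rightarrow> int" and n :: int
  assumes n: "0 \<le> n"
    and range: "\<And>x t. x \<in> X \<Longrightarrow> t \<in> {0..n} \<Longrightarrow> h x t \<in> {0..n}"
    and close: "\<And>x x' t t'. x \<in> X \<Longrightarrow> x' \<in> X \<Longrightarrow> t \<in> {0..n} \<Longrightarrow> t' \<in> {0..n} \<Longrightarrow>
      \<kappa> x x' \<or> x = x' \<Longrightarrow> \<bar>t - t'\<bar> \<le> 1 \<Longrightarrow> \<bar>h x t - h x' t'\<bar> \<le> 1"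
  obtains s :: "'a \<Rightarrow> int"
  where "\<And>x. x \<in> X \<Longrightarrow> s x \<in> {0..n}"
    and "\<And>x. x \<in> X \<Longrightarrow> \<bar>h x (s x) - s x\<bar> \<le> 1"
    and "\<And>x x'. x \<in> X \<Longrightarrow> x' \<in> X \<Longrightarrow> \<kappa> x x' \<Longrightarrow> \<bar>s x - s x'\<bar> \<le> 1"
proof -
  define P where "P x k \<longleftrightarrow> h x (int k) \<le> int k + 1" for x and k :: nat
  define s where "s x = int (LEAST k. P x k)" for x
  have le: "s x \<le> t" if "0 \<le> t" "h x t \<le> t + 1" for x t
    using Least_le[of "P x" "nat t"] that by (simp add: P_def s_def)
  have top: "h x n \<le> n + 1" if "x \<in> X" for x
    using range[OF that, of n] n by simp
  have rng: "s x \<in> {0..n}" if "x \<in> X" for x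
    using le[OF n top[OF that]] by (simp add: s_def)
  have upper: "h x (s x) \<le> s x + 1" if "x \<in> X" for x
  proof -
    have "P x (nat n)"
      using top[OF that] n by (simp add: P_def)
    then show ?thesis
      using LeastI[of "P x" "nat n"] by (simp add: P_def s_def)
  qed
  have lower: "s x \<le> h x (s x)" if x: "x \<in> X" for x
  proof (cases "s x = 0")
    case True
    then show ?thesis using range[OF x rng[OF x]] by simp
  next
    case False
    then have pos: "0 < s x" using rng[OF x] by simp
    then have "\<not> h x (s x - 1) \<le> (s x - 1) + 1"
      using le[of "s x - 1" x] by auto
    moreover have "\<bar>h x (s x - 1) - h x (s x)\<bar> \<le> 1"
      using close[OF x x, of "s x - 1" "s x"] rng[OF x] pos by simp
    ultimately show ?thesis by linarith
  qed
  have adj: "\<bar>s x - s x'\<bar> \<le> 1" if x: "x \<in> X" and x': "x' \<in> X" and "\<kappa> x x'" for x x'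
  proof -
    have "s x' \<le> s x + 1"
    proof (cases "s x + 1 \<le> n")
      case True
      then have "\<bar>h x (s x) - h x' (s x + 1)\<bar> \<le> 1"
        using close[OF x x', of "s x" "s x + 1"] rng[OF x] that(3) by simp
      then show ?thesis
        using upper[OF x] rng[OF x] by (intro le) auto
    next
      case False
      then show ?thesis using rng[OF x'] by simp
    qed
    moreover have "s x \<le> s x' + 1"
    proof (cases "s x' + 1 \<le> n")
      case True
      then have "\<bar>h x (s x' + 1) - h x' (s x')\<bar> \<le> 1"
        using close[OF x x', of "s x' + 1" "s x'"] rng[OF x'] that(3) by simp
      then show ?thesis
        using upper[OF x'] rng[OF x'] by (intro le) auto
    next
      case False
      then show ?thesis using rng[OF x] by simp
    qed
    ultimately show ?thesis by simp
  qed
  show thesis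
  proof (rule that)
    show "\<bar>h x (s x) - s x\<bar> \<le> 1" if "x \<in> X" for x
      using upper[OF that] lower[OF that] by simp
  qed (use rng adj in auto)
qed

lemma NP_c1_or_eq_iff:
  "NP \<kappa> c1 p q \<or> p = q \<longleftrightarrow>
    (\<kappa> (fst p) (fst q) \<or> fst p = fst q) \<and> \<bar>snd p - snd q\<bar> \<le> 1"
proof -
  have "\<bar>a - b\<bar> \<le> 1 \<longleftrightarrow> c1 a b \<or> a = b" for a b
    by (auto simp: c1_def)
  then show ?thesis
    by (cases p; cases q) (auto simp: NP_def)
qed

theorem theorem4p5:
  fixes X :: "(int ^ 'm) set" and \<kappa> :: "int ^ 'm \<Rightarrow> int ^ 'm \<Rightarrow> bool" and n :: int
  assumes "digital_image X \<kappa>"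
    and "AFPP X \<kappa>"
    and "n \<ge> 0"
  shows "AFPP (X \<times> {0..n}) (NP \<kappa> c1)"
  unfolding AFPP_def
proof (intro allI impI)
  let ?Y = "X \<times> {0..n}"
  fix f assume "dig_continuous ?Y (NP \<kappa> c1) f"
  then have f: "f \<in> ?Y \<rightarrow> ?Y"
    and f_adj: "\<forall>p\<in>?Y. \<forall>q\<in>?Y. NP \<kappa> c1 p q \<longrightarrow> NP \<kappa> c1 (f p) (f q) \<or> f p = f q"
    unfolding dig_continuous_iff[OF digital_image_NP[OF assms(1) digital_image_c1]]
    by (rule conjunct1, rule conjunct2)
  have f_close: "NP \<kappa> c1 (f p) (f q) \<or> f p = f q"
    if "p \<in> ?Y" "q \<in> ?Y" "NP \<kappa> c1 p q \<or> p = q" for p q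
    using that(3)
  proof
    assume "NP \<kappa> c1 p q"
    then show ?thesis by (rule f_adj[THEN bspec, THEN bspec, THEN mp, OF that(1,2)])
  qed simp
  define g where "g x t = fst (f (x, t))" for x t
  define h where "h x t = snd (f (x, t))" for x t
  have g_in: "g x t \<in> X" and h_in: "h x t \<in> {0..n}" if "x \<in> X" "t \<in> {0..n}" for x t
    using funcset_mem[OF f, of "(x, t)"] that by (auto simp: g_def h_def mem_Times_iff)
  have gh_close: "(\<kappa> (g x t) (g x' t') \<or> g x t = g x' t') \<and> \<bar>h x t - h x' t'\<bar> \<le> 1"
    if "x \<in> X" "x' \<in> X" "t \<in> {0..n}" "t' \<in> {0..n}" "\<kappa> x x' \<or> x = x'" "\<bar>t - t'\<bar> \<le> 1" for x x' t t'
    using f_close[of "(x, t)" "(x', t')"] that unfolding NP_c1_or_eq_iff g_def h_def by simp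
  obtain s where s_in: "\<And>x. x \<in> X \<Longrightarrow> s x \<in> {0..n}"
    and s_near: "\<And>x. x \<in> X \<Longrightarrow> \<bar>h x (s x) - s x\<bar> \<le> 1"
    and s_close: "\<And>x x'. x \<in> X \<Longrightarrow> x' \<in> X \<Longrightarrow> \<kappa> x x' \<Longrightarrow> \<bar>s x - s x'\<bar> \<le> 1"
  proof (rule nearly_fixed_height_selection[of n X h \<kappa>])
    show "0 \<le> n" by (fact assms(3))
    show "h x t \<in> {0..n}" if "x \<in> X" "t \<in> {0..n}" for x t
      using that by (rule h_in)
    show "\<bar>h x t - h x' t'\<bar> \<le> 1"
      if "x \<in> X" "x' \<in> X" "t \<in> {0..n}" "t' \<in> {0..n}" "\<kappa> x x' \<or> x = x'" "\<bar>t - t'\<bar> \<le> 1" for x x' t t'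
      using gh_close[OF that] by (rule conjunct2)
  qed (rule that)
  have "dig_continuous X \<kappa> (\<lambda>x. g x (s x))"
    unfolding dig_continuous_iff[OF assms(1)]
  proof (intro conjI ballI impI funcsetI)
    show "g x (s x) \<in> X" if "x \<in> X" for x
      using g_in[OF that s_in[OF that]] .
    show "\<kappa> (g x (s x)) (g x' (s x')) \<or> g x (s x) = g x' (s x')"
      if "x \<in> X" "x' \<in> X" "\<kappa> x x'" for x x'
      using gh_close[OF that(1,2) s_in[OF that(1)] s_in[OF that(2)] disjI1[OF that(3)] s_close[OF that]]
      by (rule conjunct1)
  qed
  then obtain x where x: "x \<in> X" "\<kappa> (g x (s x)) x \<or> g x (s x) = x"
    using assms(2) unfolding AFPP_def by blast
  have "NP \<kappa> c1 (f (x, s x)) (x, s x) \<or> f (x, s x) = (x, s x)"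
    unfolding NP_c1_or_eq_iff using x(2) s_near[OF x(1)] by (simp add: g_def h_def)
  moreover have "(x, s x) \<in> ?Y"
    using x(1) s_in by simp
  ultimately show "\<exists>p\<in>?Y. NP \<kappa> c1 (f p) p \<or> f p = p"
    by blast
qed

end
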